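(* For every positive integer $n$, $\mu_2(n)\le 4n$. That is, for every graph $G$ on $n$ vertices and all independent sets $I,I'$ of $G$ with $|I|=|I'|=2$ such that $I$ can be transformed into $I'$ by token sliding (i.e. $\mathrm{dist}_{\mathcal{R}_2(G)}(I,I')<\infty$), we have $\mathrm{dist}_{\mathcal{R}_2(G)}(I,I')\le 4n$.
   Context: All graphs are finite, undirected and simple. For a graph $G$ and a positive integer $k$, the token sliding reconfiguration graph $\mathcal{R}_k(G)$ has as vertices the independent sets of $G$ of size $k$; two such sets $I,I'$ are adjacent in $\mathcal{R}_k(G)$ if and only if $I\setminus I'=\{a\}$, $I'\setminus I=\{b\}$ and $ab\in E(G)$ for some vertices $a,b$ (one token slides along an edge, the tokens occupying an independent set before and after the move). $\mathrm{dist}_{\mathcal{R}_k(G)}(I,I')$ is the distance between $I$ and $I'$ in $\mathcal{R}_k(G)$ (the minimum number of moves), equal to $\infty$ if they lie in different connected components. Define $$\mu_k(n)=\max_{G:\,|V(G)|=n}\ \max_{\substack{I,I'\in V(\mathcal{R}_k(G))\\ \mathrm{dist}_{\mathcal{R}_k(G)}(I,I')<\infty}}\mathrm{dist}_{\mathcal{R}_k(G)}(I,I'),$$ where a maximum over an empty collection is taken to be $0$. *)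

theory Defs
  imports "Graph_Theory.Graph_Theory" "HOL-Library.Extended_Nat"
begin

text \<open>
  A finite simple undirected graph is a \<^locale>\<open>pair_graph\<close>: a finite vertex set
  together with a symmetric, irreflexive edge relation on it, so an edge \<open>uv\<close>
  occurs as the two pairs \<open>(u, v)\<close> and \<open>(v, u)\<close>.
\<close>

definition independent_set :: "'a pair_pre_digraph \<Rightarrow> 'a set \<Rightarrow> bool" where
  "independent_set G I \<longleftrightarrow> I \<subseteq> pverts G \<and> (\<forall>u\<in>I. \<forall>v\<in>I. (u, v) \<notin> parcs G)"

definition token_configs :: "nat \<Rightarrow> 'a pair_pre_digraph \<Rightarrow> 'a set set" where
  "token_configs k G = {I. independent_set G I \<and> card I = k}"

definition token_graph :: "nat \<Rightarrow> 'a pair_pre_digraph \<Rightarrow> 'a set pair_pre_digraph" where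
  "token_graph k G =
     \<lparr> pverts = token_configs k G,
       parcs = {(I, I'). I \<in> token_configs k G \<and> I' \<in> token_configs k G \<and>
                 (\<exists>a b. I - I' = {a} \<and> I' - I = {b} \<and> (a, b) \<in> parcs G)} \<rparr>"

text \<open>
  The number of edges of a shortest walk. If there is no walk, this is the infimum
  of the empty set, that is \<open>\<infinity>\<close>.
\<close>

definition graph_dist :: "'a pair_pre_digraph \<Rightarrow> 'a \<Rightarrow> 'a \<Rightarrow> enat" where
  "graph_dist G u v = (INF p\<in>{p. pre_digraph.awalk (with_proj G) u p v}. enat (length p))"

text \<open>
  Every graph with \<open>n\<close> vertices is isomorphic to one whose vertices are natural numbers,
  so the graphs on vertices of type \<^typ>\<open>nat\<close> represent all of them. The supremum of the
  empty set in \<^typ>\<open>enat\<close> is \<open>0\<close>, and a finite supremum of a nonempty set is attained.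
\<close>

definition token_mu :: "nat \<Rightarrow> nat \<Rightarrow> enat" where
  "token_mu k n =
     (SUP G\<in>{G :: nat pair_pre_digraph. pair_graph G \<and> card (pverts G) = n}.
      SUP (I, I')\<in>{(I, I'). I \<in> pverts (token_graph k G) \<and> I' \<in> pverts (token_graph k G) \<and>
                      graph_dist (token_graph k G) I I' < \<infinity>}.
        graph_dist (token_graph k G) I I')"

lemma pair_graph_token_graph:
  assumes "pair_graph G"
  shows "pair_graph (token_graph k G)"
proof -
  interpret pair_graph G by fact
  have "token_configs k G \<subseteq> Pow (pverts G)"
    by (auto simp: token_configs_def independent_set_def)
  then have fin: "finite (token_configs k G)"
    using pair_finite_verts by (meson finite_Pow_iff finite_subset)
  have "parcs (token_graph k G) \<subseteq> token_configs k G \<times> token_configs k G"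
    by (auto simp: token_graph_def)
  then have "finite (parcs (token_graph k G))"
    using fin by (meson finite_SigmaI finite_subset)
  moreover have "sym (parcs (token_graph k G))"
    proof (rule symI)
    fix I I' assume "(I, I') \<in> parcs (token_graph k G)"
    then obtain a b where *: "I \<in> token_configs k G" "I' \<in> token_configs k G"
        "I - I' = {a}" "I' - I = {b}" "(a, b) \<in> parcs G"
      unfolding token_graph_def by auto
    have "sym (parcs G)"
      using pair_sym_arcs by (simp add: symmetric_def)
    then have "(b, a) \<in> parcs G"
      using *(5) by (rule symD)
    then show "(I', I) \<in> parcs (token_graph k G)"
      using *(1-4) unfolding token_graph_def by simp
  qed
  moreover have "fst e \<in> pverts (token_graph k G) \<and> snd e \<in> pverts (token_graph k G) \<and> fst e \<noteq> snd e"
    if "e \<in> parcs (token_graph k G)" for e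
    using that by (cases e) (auto simp: token_graph_def)
  moreover have "finite (pverts (token_graph k G))"
    using fin by (simp add: token_graph_def)
  ultimately show ?thesis
    by unfold_locales (simp_all add: symmetric_def)
qed

lemma graph_dist_finite_iff:
  assumes "pair_wf_digraph G"
  shows "graph_dist G u v < \<infinity> \<longleftrightarrow> u \<rightarrow>\<^sup>*\<^bsub>with_proj G\<^esub> v"
proof -
  have "wf_digraph (with_proj G)"
    using assms by (simp add: wf_digraph_wp_iff)
  then have "u \<rightarrow>\<^sup>*\<^bsub>with_proj G\<^esub> v \<longleftrightarrow> {p. pre_digraph.awalk (with_proj G) u p v} \<noteq> {}"
    by (simp add: wf_digraph.reachable_awalk)
  then show ?thesis
    unfolding graph_dist_def INF_less_iff by (simp only: enat_ord_code(4)) blast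
qed

end

theory Submission
  imports Defs
begin

text \<open>
  Write \<open>N(X)\<close> for the set of vertices outside \<open>X\<close> with a neighbour in \<open>X\<close>.
  Fix a configuration \<open>I\<close>, and let \<open>V\<close> be the set of all vertices that carry a token in some
  configuration reachable from \<open>I\<close>. The route from \<open>I\<close> to a reachable \<open>I'\<close> passes through a
  well-chosen hub vertex \<open>w \<in> V\<close>: bring a token to \<open>w\<close>, move the other token while this one
  rests, and then follow in reverse a route that brings a token from \<open>I'\<close> to \<open>w\<close>. Each of the
  three parts takes at most \<open>n\<close> moves, so the whole route takes at most \<open>3n\<close>.

  Reaching a vertex is cheap (\<open>reach_vertex_within_card\<close>). Let \<open>S\<close> be the set of vertices that
  can be occupied within \<open>i\<close> moves from \<open>I\<close>. Suppose that \<open>x\<close> lies outside \<open>S\<close> and that no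
  single further move leads to \<open>x\<close>. Then in each configuration within distance \<open>i\<close> both tokens
  are adjacent to \<open>x\<close> or neither is, since otherwise one of them could slide to \<open>x\<close>. Consecutive
  configurations share a token, so the same alternative holds for all of \<open>S\<close>. But then no move
  from a configuration inside \<open>S\<close> ever leads to \<open>x\<close>. Hence \<open>S\<close> gains a vertex with every further
  move until it equals \<open>V\<close>.

  The hub is found by an extremal choice (\<open>hub_exists\<close>). Among all nonempty connected sets
  \<open>C \<subseteq> V\<close> that miss some vertex of \<open>V\<close> together with all its neighbours, take one of maximal
  size. Let \<open>D\<close> be the set of vertices of \<open>V\<close> missed by \<open>C\<close> in this sense. So \<open>V\<close> is the
  disjoint union of \<open>C\<close>, \<open>N(C) \<inter> V\<close> and \<open>D\<close>. If some \<open>z \<in> N(C) \<inter> V\<close> were not adjacent to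
  some \<open>u \<in> D\<close>, then \<open>C\<close> with \<open>z\<close> added would still miss \<open>u\<close>, against maximality. So \<open>D\<close>
  is completely joined to \<open>N(C) \<inter> V\<close> and has no edge to \<open>C\<close>. Two tokens in \<open>D\<close> can therefore
  never leave \<open>D\<close>; as moves are reversible and \<open>C\<close> is nonempty, no reachable configuration lies
  inside \<open>D\<close>. Now let \<open>w \<in> D\<close>. In a reachable configuration \<open>{w, x}\<close> the vertex \<open>x\<close> is
  neither in \<open>D\<close> nor in \<open>N(C)\<close>, so it is in \<open>C\<close>. Any two such configurations are joined by
  sliding the second token inside \<open>C\<close>, which is connected and contains no neighbour of \<open>w\<close>.
\<close>

section \<open>Number of steps and graph distance\<close>

lemma relpow_mono_rel: "R \<subseteq> S \<Longrightarrow> R ^^ k \<subseteq> S ^^ k" for R S :: "'a rel"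
  by (induction k) (auto simp: relcomp.simps)

lemma graph_dist_le_relpow:
  assumes "pair_wf_digraph H" "u \<in> pverts H" "(u, v) \<in> parcs H ^^ k"
  shows "graph_dist H u v \<le> enat k"
proof -
  interpret pair_wf_digraph H by fact
  have "\<exists>p. awalk u p v \<and> length p = k"
    using assms(2,3)
  proof (induction k arbitrary: u)
    case 0
    then show ?case by (intro exI[of _ "[]"]) (auto simp: awalk_Nil_iff)
  next
    case (Suc k)
    from Suc.prems(2) obtain w where w: "(u, w) \<in> parcs H" "(w, v) \<in> parcs H ^^ k"
      by (rule relpow_Suc_E2)
    from w(1) have "w \<in> pverts H" by (rule in_arcsD2)
    with Suc.IH w(2) obtain p where "awalk w p v" "length p = k" by blast
    with w(1) Suc.prems(1) show ?case
      by (intro exI[of _ "(u, w) # p"]) (auto simp: awalk_Cons_iff)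
  qed
  then show ?thesis
    unfolding graph_dist_def by (metis INF_lower mem_Collect_eq)
qed

lemma rtrancl_if_graph_dist_finite:
  assumes "pair_wf_digraph H" "graph_dist H u v < \<infinity>"
  shows "(u, v) \<in> (parcs H)\<^sup>*"
proof -
  interpret pair_wf_digraph H by fact
  have "(u, v) \<in> rtrancl_on (pverts H) (parcs H)"
    using assms graph_dist_finite_iff[of H u v] by (simp add: reachable_def)
  then show ?thesis by (rule rtrancl_on_rtranclI)
qed

context pair_graph
begin

abbreviation moves :: "'a set rel" where
  "moves \<equiv> parcs (token_graph 2 G)"

section \<open>Two tokens\<close>

lemma arcs_sym: "(u, v) \<in> parcs G \<Longrightarrow> (v, u) \<in> parcs G"
  using pair_sym_arcs by (simp add: symmetric_def symD)

lemma sym_moves: "sym moves"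
proof -
  interpret T: pair_graph "token_graph 2 G"
    by (rule pair_graph_token_graph) unfold_locales
  show ?thesis using T.pair_sym_arcs by (simp add: symmetric_def)
qed

lemma relpow_moves_commute: "(I, J) \<in> moves ^^ k \<Longrightarrow> (J, I) \<in> moves ^^ k"
proof (induction k arbitrary: J)
  case (Suc k)
  then obtain K where "(I, K) \<in> moves ^^ k" "(K, J) \<in> moves" by auto
  with Suc.IH sym_moves show ?case by (meson relpow_Suc_I2 symD)
qed simp

lemma reachable_sym: "(I, J) \<in> moves\<^sup>* \<Longrightarrow> (J, I) \<in> moves\<^sup>*"
  using sym_rtrancl[OF sym_moves] by (rule symD)

lemma moves_configs:
  assumes "(I, J) \<in> moves"
  shows "I \<in> token_configs 2 G" "J \<in> token_configs 2 G"
  using assms by (auto simp: token_graph_def)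

lemma reachable_configs:
  assumes "I \<in> token_configs 2 G" "(I, J) \<in> moves\<^sup>*"
  shows "J \<in> token_configs 2 G"
  using assms(2,1) by induction (auto dest: moves_configs)

lemma pair_config_iff:
  "{u, v} \<in> token_configs 2 G \<longleftrightarrow>
     u \<in> pverts G \<and> v \<in> pverts G \<and> u \<noteq> v \<and> (u, v) \<notin> parcs G"
proof -
  have "(u, u) \<notin> parcs G" "(v, v) \<notin> parcs G" using pair_no_loops by fastforce+
  moreover have "(u, v) \<notin> parcs G \<Longrightarrow> (v, u) \<notin> parcs G" using arcs_sym by blast
  ultimately show ?thesis
    by (auto simp: token_configs_def independent_set_def card_insert_if)
qed

lemma config_contains:
  assumes "J \<in> token_configs 2 G" "u \<in> J"
  obtains v where "J = {u, v}"
proof -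
  from assms(1) obtain a b where "J = {a, b}"
    by (auto simp: token_configs_def card_2_iff)
  with assms(2) that show thesis by auto
qed

lemma slide:
  assumes "{p, q} \<in> token_configs 2 G" "(p, x) \<in> parcs G" "(x, q) \<notin> parcs G"
  shows "({p, q}, {x, q}) \<in> moves"
proof -
  have pq: "p \<noteq> q" "(p, q) \<notin> parcs G" "q \<in> pverts G"
    using assms(1) by (auto simp: pair_config_iff)
  have x: "x \<noteq> p" "x \<noteq> q" "x \<in> pverts G"
    using assms(2) pq pair_no_loops[of "(p, x)"] by (auto dest: in_arcsD2)
  have "{x, q} \<in> token_configs 2 G"
    using pq x assms(3) by (simp add: pair_config_iff)
  moreover have "{p, q} - {x, q} = {p}" "{x, q} - {p, q} = {x}"
    using pq x by auto
  ultimately show ?thesis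
    using assms(1,2) by (auto simp: token_graph_def)
qed

lemma moveE:
  assumes "(I, J) \<in> moves"
  obtains p q x where "I = {p, q}" "J = {x, q}" "(p, x) \<in> parcs G" "(x, q) \<notin> parcs G"
proof -
  obtain p x where px: "I - J = {p}" "J - I = {x}" "(p, x) \<in> parcs G"
    using assms by (auto simp: token_graph_def)
  have I: "I \<in> token_configs 2 G" and J: "J \<in> token_configs 2 G"
    using assms by (rule moves_configs)+
  obtain q where q: "I = {p, q}" using config_contains[OF I] px(1) by blast
  then have "q \<noteq> p" using I by (auto simp: pair_config_iff)
  then have "q \<in> J" using q px(1) by auto
  moreover obtain y where "J = {x, y}" using config_contains[OF J] px(2) by blast
  moreover have "q \<noteq> x" using px(2) q by auto
  ultimately have Jxq: "J = {x, q}" by auto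
  with J have "(x, q) \<notin> parcs G" by (simp add: pair_config_iff)
  with q Jxq px(3) show thesis by (rule that)
qed

section \<open>Occupying a prescribed vertex\<close>

definition occupied_within :: "'a set \<Rightarrow> nat \<Rightarrow> 'a set" where
  "occupied_within I i = \<Union>{J. \<exists>k\<le>i. (I, J) \<in> moves ^^ k}"

lemma occupied_within_mono: "i \<le> j \<Longrightarrow> occupied_within I i \<subseteq> occupied_within I j"
  unfolding occupied_within_def by (rule Union_mono, rule Collect_mono) (auto intro: le_trans)

text \<open>
  Once a move adds no new vertex, no later move does: a vertex \<open>x\<close> outside the occupied set that
  cannot be occupied by one more move has either all or none of that set as neighbours, whereas a
  slide to \<open>x\<close> needs one token adjacent to \<open>x\<close> and the other not.
\<close>

lemma occupied_within_stable:
  assumes I: "I \<in> token_configs 2 G"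
    and stable: "occupied_within I (Suc i) = occupied_within I i"
    and "(I, J) \<in> moves\<^sup>*"
  shows "J \<subseteq> occupied_within I i"
  using assms(3)
proof induction
  case base
  have "(I, I) \<in> moves ^^ 0" by simp
  then show ?case unfolding occupied_within_def by blast
next
  case (step J J')
  from step.hyps(2) obtain p q x
    where J: "J = {p, q}" and J': "J' = {x, q}"
      and px: "(p, x) \<in> parcs G" and xq: "(x, q) \<notin> parcs G"
    by (rule moveE)
  have "x \<in> occupied_within I i"
  proof (rule ccontr)
    assume x: "x \<notin> occupied_within I i"
    \<comment> \<open>A token adjacent to \<open>x\<close> whose partner is not adjacent to \<open>x\<close> could slide to \<open>x\<close>.\<close>
    have same: "(b, x) \<in> parcs G"
      if K: "(I, K) \<in> moves ^^ k" "k \<le> i" and ab: "a \<in> K" "b \<in> K" "(a, x) \<in> parcs G"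
      for K k a b
    proof (rule ccontr)
      assume b: "(b, x) \<notin> parcs G"
      have "K \<in> token_configs 2 G"
        using reachable_configs[OF I] K(1) relpow_imp_rtrancl by blast
      moreover from this have Kab: "K = {a, b}"
        using ab b by (auto elim!: config_contains)
      ultimately have "{a, b} \<in> token_configs 2 G" by simp
      moreover have "(x, b) \<notin> parcs G" using b arcs_sym by blast
      ultimately have "({a, b}, {x, b}) \<in> moves"
        using ab(3) by (intro slide)
      then have "(I, {x, b}) \<in> moves ^^ Suc k"
        using K(1) Kab by (auto intro: relpow_Suc_I)
      then have "x \<in> occupied_within I (Suc i)"
        unfolding occupied_within_def using K(2) by blast
      with stable x show False by simp
    qed
    \<comment> \<open>Consecutive configurations share a token, so the alternative chosen by \<open>I\<close> spreads.\<close>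
    have uniform: "\<forall>a\<in>K. (a, x) \<in> parcs G \<longleftrightarrow> (\<exists>c\<in>I. (c, x) \<in> parcs G)"
      if "(I, K) \<in> moves ^^ k" "k \<le> i" for K k
      using that
    proof (induction k arbitrary: K)
      case 0
      then have "K = I" by simp
      moreover have "(a, x) \<in> parcs G \<longleftrightarrow> (b, x) \<in> parcs G" if "a \<in> K" "b \<in> K" for a b
        using same[OF 0] that by blast
      ultimately show ?case by blast
    next
      case (Suc k)
      then obtain L where L: "(I, L) \<in> moves ^^ k" "(L, K) \<in> moves" by auto
      from L(2) obtain u v w where "L = {u, v}" "K = {w, v}" by (rule moveE)
      moreover have "\<forall>a\<in>L. (a, x) \<in> parcs G \<longleftrightarrow> (\<exists>c\<in>I. (c, x) \<in> parcs G)"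
        using Suc.IH[OF L(1)] Suc.prems(2) by simp
      moreover have "(a, x) \<in> parcs G \<longleftrightarrow> (b, x) \<in> parcs G" if "a \<in> K" "b \<in> K" for a b
        using same[OF Suc.prems] that by blast
      ultimately show ?case by blast
    qed
    have "p \<in> occupied_within I i" "q \<in> occupied_within I i"
      using step.IH J by auto
    then have "(p, x) \<in> parcs G \<longleftrightarrow> (q, x) \<in> parcs G"
      unfolding occupied_within_def using uniform by blast
    with px xq show False using arcs_sym by blast
  qed
  with step.IH J J' show ?case by auto
qed

text \<open>
  The occupied sets form a chain that is strictly increasing until it is constant, so it is
  constant after at most as many moves as there are vertices.
\<close>

lemma reach_vertex_within_card:
  assumes I: "I \<in> token_configs 2 G" and J: "(I, J) \<in> moves\<^sup>*" "w \<in> J"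
  shows "\<exists>K. \<exists>k\<le>card (pverts G). (I, K) \<in> moves ^^ k \<and> w \<in> K"
proof -
  let ?S = "occupied_within I"
  have sub: "?S i \<subseteq> pverts G" for i
    using reachable_configs[OF I] relpow_imp_rtrancl
    unfolding occupied_within_def token_configs_def independent_set_def by blast
  then have fin: "finite (?S i)" for i
    using finite_subset pair_finite_verts by blast
  have grow: "i \<le> card (?S i)" if "\<forall>j<i. ?S (Suc j) \<noteq> ?S j" for i
    using that
  proof (induction i)
    case (Suc i)
    then have "?S i \<subset> ?S (Suc i)"
      using occupied_within_mono[of i "Suc i" I] by auto
    then have "card (?S i) < card (?S (Suc i))"
      using fin psubset_card_mono by blast
    with Suc show ?case by fastforce
  qed simp
  have "\<exists>j\<le>card (pverts G). ?S (Suc j) = ?S j"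
  proof (rule ccontr)
    assume "\<not> ?thesis"
    then have "Suc (card (pverts G)) \<le> card (?S (Suc (card (pverts G))))"
      by (intro grow) auto
    also have "\<dots> \<le> card (pverts G)"
      using sub pair_finite_verts by (intro card_mono)
    finally show False by simp
  qed
  then obtain j where j: "j \<le> card (pverts G)" "?S (Suc j) = ?S j" by blast
  from occupied_within_stable[OF I j(2) J(1)] J(2) have "w \<in> ?S j" by blast
  with j(1) show ?thesis unfolding occupied_within_def using le_trans by blast
qed

section \<open>A vertex whose configurations are close to each other\<close>

text \<open>
  For finite \<open>C\<close> this is connectedness of the induced subgraph. The explicit bound on the length of
  the walks is what \<open>hub_exists\<close> uses to count moves.
\<close>

definition short_connected :: "'a set \<Rightarrow> bool" where
  "short_connected C \<longleftrightarrow>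
     (\<forall>x\<in>C. \<forall>y\<in>C. \<exists>k<card C. (x, y) \<in> (Restr (parcs G) C) ^^ k)"

lemma short_connected_singleton: "short_connected {x}"
  by (simp add: short_connected_def)

lemma short_connected_insert:
  assumes "short_connected C" "finite C" "z \<notin> C" "c \<in> C" "(z, c) \<in> parcs G"
  shows "short_connected (insert z C)"
proof -
  let ?R = "Restr (parcs G) C" and ?R' = "Restr (parcs G) (insert z C)"
  have zc: "(z, c) \<in> ?R'" "(c, z) \<in> ?R'"
    using assms(4,5) arcs_sym[OF assms(5)] by simp_all
  have mono: "?R ^^ k \<subseteq> ?R' ^^ k" for k by (rule relpow_mono_rel) auto
  have old: "\<exists>k<card C. (x, y) \<in> ?R' ^^ k" if "x \<in> C" "y \<in> C" for x y
  proof -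
    from assms(1) that obtain k where "k < card C" "(x, y) \<in> ?R ^^ k"
      unfolding short_connected_def by meson
    with mono show ?thesis by (meson subsetD)
  qed
  have "\<exists>k<card (insert z C). (x, y) \<in> ?R' ^^ k" if xy: "x \<in> insert z C" "y \<in> insert z C" for x y
  proof -
    consider "x = z" "y = z" | "x = z" "y \<in> C" | "x \<in> C" "y = z" | "x \<in> C" "y \<in> C"
      using xy by auto
    then show ?thesis
    proof cases
      case 1
      then show ?thesis by (intro exI[of _ 0]) (simp add: card_gt_0_iff assms(2))
    next
      case 2
      with old[OF assms(4)] obtain k where "k < card C" "(c, y) \<in> ?R' ^^ k" by blast
      then have "(x, y) \<in> ?R' ^^ Suc k" "Suc k < card (insert z C)"
        using relpow_Suc_I2[OF zc(1)] 2 assms(2,3) by (blast, simp)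
      then show ?thesis by blast
    next
      case 3
      with old[OF _ assms(4)] obtain k where "k < card C" "(x, c) \<in> ?R' ^^ k" by blast
      then have "(x, y) \<in> ?R' ^^ Suc k" "Suc k < card (insert z C)"
        using relpow_Suc_I[OF _ zc(2)] 3 assms(2,3) by (blast, simp)
      then show ?thesis by blast
    next
      case 4
      with old[of x y] obtain k where "k < card C" "(x, y) \<in> ?R' ^^ k" by blast
      moreover have "card C < card (insert z C)" using assms(2,3) by simp
      ultimately show ?thesis using less_trans by blast
    qed
  qed
  then show ?thesis unfolding short_connected_def by blast
qed

lemma slide_along_walk:
  assumes "{w, x} \<in> token_configs 2 G" "(x, y) \<in> (Restr (parcs G) C) ^^ k"
    and "\<forall>c\<in>C. (w, c) \<notin> parcs G"
  shows "({w, x}, {w, y}) \<in> moves ^^ k"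
  using assms(2)
proof (induction k arbitrary: y)
  case (Suc k)
  then obtain z where z: "(x, z) \<in> (Restr (parcs G) C) ^^ k" "(z, y) \<in> parcs G" "y \<in> C"
    by auto
  have m: "({w, x}, {w, z}) \<in> moves ^^ k" using z(1) by (rule Suc.IH)
  then have "{z, w} \<in> token_configs 2 G"
    using reachable_configs[OF assms(1)] relpow_imp_rtrancl insert_commute by metis
  moreover have "(y, w) \<notin> parcs G" using z(3) assms(3) arcs_sym by blast
  ultimately have "({z, w}, {y, w}) \<in> moves"
    using z(2) by (intro slide)
  then have "({w, z}, {w, y}) \<in> moves" by (simp add: insert_commute)
  with m show ?case by (rule relpow_Suc_I)
qed simp

text \<open>
  The hub \<open>w\<close> is a vertex outside \<open>C\<close> and without neighbours in \<open>C\<close>, for a connected set \<open>C\<close>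
  that is as large as one with such a vertex can be. Maximality of \<open>C\<close>
  forces the partner of a token on \<open>w\<close> into \<open>C\<close>, where it can travel freely.
\<close>

lemma hub_exists:
  assumes I: "I \<in> token_configs 2 G"
  obtains w J where "(I, J) \<in> moves\<^sup>*" "w \<in> J"
    and "\<forall>K L. (I, K) \<in> moves\<^sup>* \<and> w \<in> K \<and> (I, L) \<in> moves\<^sup>* \<and> w \<in> L \<longrightarrow>
           (\<exists>k\<le>card (pverts G). (K, L) \<in> moves ^^ k)"
proof -
  define V where "V = \<Union>{J. (I, J) \<in> moves\<^sup>*}"
  define avoided where "avoided C w \<longleftrightarrow> w \<notin> C \<and> (\<forall>c\<in>C. (w, c) \<notin> parcs G)" for C w
  define P where "P C \<longleftrightarrow> C \<subseteq> V \<and> C \<noteq> {} \<and> short_connected C \<and> (\<exists>w\<in>V. avoided C w)" for C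
  have V: "V \<subseteq> pverts G"
    using reachable_configs[OF I]
    unfolding V_def token_configs_def independent_set_def by blast
  have finV: "finite V" using V pair_finite_verts finite_subset by blast

  obtain a b where ab: "I = {a, b}" using I by (auto simp: token_configs_def card_2_iff)
  have "a \<in> V" "b \<in> V" unfolding V_def using ab by blast+
  \<comment> \<open>A witness that some set is missed: one token of \<open>I\<close> misses the other.\<close>
  then have "P {b}"
    using I ab unfolding P_def avoided_def
    by (auto simp: pair_config_iff short_connected_singleton)
  moreover have "\<forall>C. P C \<longrightarrow> card C < Suc (card V)"
    using finV by (auto simp: P_def less_Suc_eq_le intro: card_mono)
  ultimately obtain C where C: "P C" and max: "\<And>C'. P C' \<Longrightarrow> card C' \<le> card C"
    using ex_has_greatest_nat[of P "{b}" card "Suc (card V)"] by blast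
  from C have CV: "C \<subseteq> V" "C \<noteq> {}" "short_connected C" by (auto simp: P_def)
  from C obtain w where w: "w \<in> V" "avoided C w" by (auto simp: P_def)
  have finC: "finite C" using CV(1) finV finite_subset by blast

  \<comment> \<open>\<open>D\<close> collects all vertices missed by \<open>C\<close>; in \<open>V\<close> it is joined completely to \<open>N(C)\<close>.\<close>
  define D where "D = {u\<in>V. avoided C u}"
  have complete: "(z, u) \<in> parcs G"
    if z: "z \<in> V" "z \<notin> C" "c \<in> C" "(z, c) \<in> parcs G" and u: "u \<in> D" for z c u
  proof (rule ccontr)
    assume "(z, u) \<notin> parcs G"
    then have "avoided (insert z C) u"
      using z u arcs_sym unfolding avoided_def D_def by blast
    moreover have "short_connected (insert z C)"
      using short_connected_insert[OF CV(3) finC] z by blast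
    ultimately have "P (insert z C)" using z u CV(1) unfolding P_def D_def by blast
    from max[OF this] z(2) finC show False by simp
  qed

  \<comment> \<open>Leaving \<open>D\<close> would mean sliding onto a vertex of \<open>N(C)\<close>, which the other token blocks.\<close>
  have closed: "K' \<subseteq> D" if "(K, K') \<in> moves" "K \<subseteq> D" "(I, K) \<in> moves\<^sup>*" for K K'
  proof -
    from that(1) obtain p q x where K: "K = {p, q}" "K' = {x, q}"
      and px: "(p, x) \<in> parcs G" and xq: "(x, q) \<notin> parcs G" by (rule moveE)
    have "(I, K') \<in> moves\<^sup>*" using that by auto
    then have "x \<in> V" unfolding V_def using K by blast
    moreover have "p \<in> D" "q \<in> D" using that(2) K by auto
    moreover from \<open>p \<in> D\<close> have "x \<notin> C" using px unfolding D_def avoided_def by blast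
    ultimately have "x \<in> D" using complete xq unfolding D_def avoided_def by blast
    with \<open>q \<in> D\<close> K show ?thesis by auto
  qed
  \<comment> \<open>Otherwise, by reversibility, every reachable configuration would lie in \<open>D\<close> and \<open>C\<close> would be empty.\<close>
  have not_in_D: "\<not> K \<subseteq> D" if K: "(I, K) \<in> moves\<^sup>*" for K
  proof
    assume "K \<subseteq> D"
    have inD: "L \<subseteq> D \<and> (I, L) \<in> moves\<^sup>*" if "(K, L) \<in> moves\<^sup>*" for L
      using that
    proof induction
      case base
      then show ?case using \<open>K \<subseteq> D\<close> K by blast
    next
      case (step L L')
      then show ?case using closed[of L L'] by (auto intro: rtrancl_into_rtrancl)
    qed
    have "J \<subseteq> D" if "(I, J) \<in> moves\<^sup>*" for J
      using inD[OF rtrancl_trans[OF reachable_sym[OF K] that]] by (rule conjunct1)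
    then have "V \<subseteq> D" unfolding V_def by blast
    with CV show False unfolding D_def avoided_def by blast
  qed

  have opposite: "\<exists>x\<in>C. K = {w, x}" if K: "(I, K) \<in> moves\<^sup>*" "w \<in> K" for K
  proof -
    have Kc: "K \<in> token_configs 2 G" using reachable_configs[OF I] K(1) .
    then obtain x where x: "K = {w, x}" using K(2) by (rule config_contains)
    then have "{x, w} \<in> token_configs 2 G" using Kc by (simp add: insert_commute)
    then have wx: "(x, w) \<notin> parcs G" by (simp add: pair_config_iff)
    have "x \<in> V" unfolding V_def using K(1) x by blast
    have "w \<in> D" using w by (simp add: D_def)
    then have "x \<notin> D" using not_in_D[OF K(1)] x by blast
    then have "x \<in> C"
      using complete[OF \<open>x \<in> V\<close> _ _ _ \<open>w \<in> D\<close>] wx \<open>x \<in> V\<close> unfolding D_def avoided_def by blast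
    with x show ?thesis by blast
  qed
  have close: "\<exists>k\<le>card (pverts G). (K, L) \<in> moves ^^ k"
    if KL: "(I, K) \<in> moves\<^sup>*" "w \<in> K" "(I, L) \<in> moves\<^sup>*" "w \<in> L" for K L
  proof -
    obtain x y where x: "x \<in> C" "K = {w, x}" and y: "y \<in> C" "L = {w, y}"
      using opposite KL by meson
    obtain k where k: "k < card C" "(x, y) \<in> (Restr (parcs G) C) ^^ k"
      using CV(3) x(1) y(1) unfolding short_connected_def by blast
    have "{w, x} \<in> token_configs 2 G" using reachable_configs[OF I KL(1)] x(2) by simp
    from slide_along_walk[OF this k(2)] w(2) x(2) y(2) have "(K, L) \<in> moves ^^ k"
      by (simp add: avoided_def)
    moreover have "card C \<le> card (pverts G)"
      using CV(1) V pair_finite_verts by (intro card_mono) auto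
    ultimately show ?thesis using k(1) by (intro exI[of _ k]) simp
  qed
  obtain J where "(I, J) \<in> moves\<^sup>*" "w \<in> J" using w(1) unfolding V_def by blast
  then show thesis using close by (intro that[of J w]) auto
qed

section \<open>The linear bound\<close>

lemma token_graph_dist_le:
  assumes I: "I \<in> token_configs 2 G" and I': "(I, I') \<in> moves\<^sup>*"
  shows "graph_dist (token_graph 2 G) I I' \<le> enat (3 * card (pverts G))"
proof -
  interpret T: pair_graph "token_graph 2 G"
    by (rule pair_graph_token_graph) unfold_locales
  let ?n = "card (pverts G)"
  obtain w J where J: "(I, J) \<in> moves\<^sup>*" "w \<in> J"
    and hub: "\<forall>K L. (I, K) \<in> moves\<^sup>* \<and> w \<in> K \<and> (I, L) \<in> moves\<^sup>* \<and> w \<in> L \<longrightarrow>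
           (\<exists>k\<le>?n. (K, L) \<in> moves ^^ k)"
    by (rule hub_exists[OF I])
  obtain K k where K: "k \<le> ?n" "(I, K) \<in> moves ^^ k" "w \<in> K"
    using reach_vertex_within_card[OF I J] by blast
  have I'c: "I' \<in> token_configs 2 G" using reachable_configs[OF I I'] .
  have "(I', I) \<in> moves\<^sup>*" using I' by (rule reachable_sym)
  then have "(I', J) \<in> moves\<^sup>*" using J(1) by (rule rtrancl_trans)
  then obtain L l where L: "l \<le> ?n" "(I', L) \<in> moves ^^ l" "w \<in> L"
    using reach_vertex_within_card[OF I'c _ J(2)] by blast
  have "(I, K) \<in> moves\<^sup>*" "(I, L) \<in> moves\<^sup>*"
    using relpow_imp_rtrancl[OF K(2)] rtrancl_trans[OF I' relpow_imp_rtrancl[OF L(2)]] .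
  then obtain m where m: "m \<le> ?n" "(K, L) \<in> moves ^^ m"
    using hub K(3) L(3) by meson
  have "I \<in> pverts (token_graph 2 G)" using I by (simp add: token_graph_def)
  moreover have "(I, I') \<in> moves ^^ (k + m + l)"
    using K(2) m(2) relpow_moves_commute[OF L(2)] by (auto simp: relpow_add)
  ultimately have "graph_dist (token_graph 2 G) I I' \<le> enat (k + m + l)"
    by (rule graph_dist_le_relpow[OF T.pair_wf_digraph_axioms])
  also have "\<dots> \<le> enat (3 * ?n)" using K(1) L(1) m(1) by simp
  finally show ?thesis .
qed

end

lemma two_token_dist_le:
  assumes G: "pair_graph G" and I: "I \<in> token_configs 2 G"
    and fin: "graph_dist (token_graph 2 G) I I' < \<infinity>"
  shows "graph_dist (token_graph 2 G) I I' \<le> enat (4 * card (pverts G))"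
proof -
  interpret pair_graph G by fact
  interpret T: pair_graph "token_graph 2 G"
    using G by (rule pair_graph_token_graph)
  have "(I, I') \<in> moves\<^sup>*"
    using rtrancl_if_graph_dist_finite[OF T.pair_wf_digraph_axioms fin] .
  from token_graph_dist_le[OF I this] show ?thesis
    by (rule order_trans) simp
qed

theorem theorem1:
  fixes n :: nat
  assumes "n > 0"
  shows "token_mu 2 n \<le> enat (4 * n) \<and>
    (\<forall>(G :: 'a pair_pre_digraph) I I'.
       pair_graph G \<longrightarrow> card (pverts G) = n \<longrightarrow>
       independent_set G I \<longrightarrow> independent_set G I' \<longrightarrow> card I = 2 \<longrightarrow> card I' = 2 \<longrightarrow>
       graph_dist (token_graph 2 G) I I' < \<infinity> \<longrightarrow>
       graph_dist (token_graph 2 G) I I' \<le> enat (4 * n))"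
proof
  show "token_mu 2 n \<le> enat (4 * n)"
    unfolding token_mu_def
    using two_token_dist_le by (fastforce intro!: SUP_least simp: token_graph_def)
next
  show "\<forall>(G :: 'a pair_pre_digraph) I I'.
       pair_graph G \<longrightarrow> card (pverts G) = n \<longrightarrow>
       independent_set G I \<longrightarrow> independent_set G I' \<longrightarrow> card I = 2 \<longrightarrow> card I' = 2 \<longrightarrow>
       graph_dist (token_graph 2 G) I I' < \<infinity> \<longrightarrow>
       graph_dist (token_graph 2 G) I I' \<le> enat (4 * n)"
    using two_token_dist_le by (auto simp: token_configs_def)
qed

end
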